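(* Let $(S_t)_{t\in\mathbb{N}}$, $S_t=\sigma_t(M_t)$, be an information state (with values in $\mathcal{S}$ and cost distribution $\rho$), and let $\mathcal{T}$ be the associated operator $$[\mathcal{T}\Lambda](s,z)=\inf_{u\in\mathcal{U}}\ \sup_{c\in\mathcal{C},\,s'\in\mathcal{S}}\Big(c+\gamma\,\Lambda(s',\gamma z)+\frac{\rho(c,s'\,|\,s,u)}{z}\Big),\qquad s\in\mathcal{S},\ z\in(0,1],$$ with $\Lambda^0\equiv 0$ and $\Lambda^{n}=\mathcal{T}^n\Lambda^0$. Then for every $n\in\mathbb{N}$, every $t\in\mathbb{N}$ and every feasible memory realization $m_t$, $$\frac{\gamma^{n+t}c^{\min}}{1-\gamma}+\gamma^t\Lambda^n(\sigma_t(m_t),\gamma^t)+\sup_{a_t\in[[A_t|m_t]]}a_t\ \le\ V_t(m_t)\ \le\ \sup_{a_t\in[[A_t|m_t]]}a_t+\gamma^t\Lambda^n(\sigma_t(m_t),\gamma^t)+\frac{\gamma^{n+t}c^{\max}}{1-\gamma}.$$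
   Context: Setting. $\mathbb{N}=\{0,1,2,\dots\}$, $\gamma\in(0,1)$. The nonempty sets $\mathcal{U},\mathcal{W},\mathcal{Y}$ are bounded subsets of a metric space $(E,\eta)$, and $\mathcal{C}\subset\mathbb{R}_{\ge0}$ is bounded with minimum $c^{\min}$ and maximum $c^{\max}$. An uncertain variable is a map $X:\Omega\to\mathcal{X}$ on a fixed sample space $\Omega$; its range is $[[X]]=\{X(\omega):\omega\in\Omega\}$, joint ranges are ranges of tuples, and the conditional range is $[[X|y]]=\{X(\omega): Y(\omega)=y,\ \omega\in\Omega\}$. Disturbances $W_t\in\mathcal{W}$, $t\in\mathbb{N}$, are independent uncertain variables (joint ranges are products of the individual ranges). The system is given by functions $h_0,h_{t+1},d_t$: with actions $U_t\in\mathcal{U}$, the observations are $Y_0=h_0(W_0)$, $Y_{t+1}=h_{t+1}(W_{0:t},U_{0:t})\in\mathcal{Y}$ and the costs are $C_t=d_t(W_{0:t},U_{0:t})\in\mathcal{C}$. The memory is $M_t=(Y_{0:t},U_{0:t-1})$, with values in $\mathcal{M}_t$ (the product of copies of $\mathcal{Y}$ and $\mathcal{U}$). A strategy is $\boldsymbol g=(g_0,g_1,\dots)$ with arbitrary $g_t:\mathcal{M}_t\to\mathcal{U}$ and $U_t=g_t(M_t)$; $\mathcal{G}$ is the set of strategies. A memory realization $m_t=(y_{0:t},u_{0:t-1})$ is feasible if some disturbance realization produces observations $y_{0:t}$ under actions $u_{0:t-1}$. Ranges conditioned on $m_t$ (or on $(m_t,u_t)$) are taken over all $\omega\in\Omega$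 whose disturbances produce $y_{0:t}$ under $u_{0:t-1}$, the past actions being $u_{0:t-1}$ (and the action at $t$ being $u_t$). A superscript $\boldsymbol g$ means that in addition all actions from time $t$ on are generated by $\boldsymbol g$. The accrued cost is $A_t=\sum_{\ell=0}^{t-1}\gamma^\ell C_\ell$ ($A_0=0$), $A_t\in\mathcal{A}=[0,a^{\max}]$, $a^{\max}=c^{\max}/(1-\gamma)$; the cost-to-go is $C_t^\infty=\sum_{\ell=t}^\infty\gamma^{\ell-t}C_\ell$. Value functions: $V_t^{\boldsymbol g}(m_t)=\sup_{(a_t,c_t^\infty)\in[[A_t,C_t^\infty|m_t]]^{\boldsymbol g}}(a_t+\gamma^tc_t^\infty)$ and $V_t(m_t)=\inf_{\boldsymbol g\in\mathcal{G}}V_t^{\boldsymbol g}(m_t)$. Indicator: $\mathbb{I}(x|y)=0$ if $x\in[[X|y]]$ and $-\infty$ otherwise. Conditional accrued distribution: $r_t(x|y)=\sup_{a_t\in\mathcal{A}}(a_t+\mathbb{I}(x,a_t|y))-\sup_{a_t\in\mathcal{A}}(a_t+\mathbb{I}(a_t|y))$. Information state: uncertain variables $S_t=\sigma_t(M_t)$, $t\in\mathbb{N}$, with values in a bounded time-invariant subset $\mathcal{S}$ of a metric space, such that there is a time-invariant cost distribution $\rho:\mathcal{C}\times\mathcal{S}\times\mathcal{S}\times\mathcal{U}\to\{-\infty\}\cup[-a^{\max},0]$, written $\rho(c,s'|s,u)$ (being a cost distribution means $\sup_{c\in\mathcal{C},s'\in\mathcal{S}}\rho(c,s'|s,u)=0$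 for all $s\in\mathcal{S},u\in\mathcal{U}$), with $r_t(c_t,s_{t+1}|m_t,u_t)=\rho(c_t,s_{t+1}|\sigma_t(m_t),u_t)$ for all $t\in\mathbb{N}$, all feasible $m_t$, all $u_t\in\mathcal{U}$, $c_t\in\mathcal{C}$, $s_{t+1}\in\mathcal{S}$; here $s_{t+1}$ is the argument for $S_{t+1}=\sigma_{t+1}(M_{t+1})$. The operator $\mathcal{T}$ acts on uniformly bounded functions $\Lambda:\mathcal{S}\times(0,1]\to\mathbb{R}$. *)

theory Defs
  imports "HOL-Analysis.Analysis"
begin

text \<open>
  Finite tuples such as \<open>W\<^sub>0, \<dots>, W\<^sub>t\<close> are lists, oldest entry first.
  The functions \<open>obs_fun P (Suc t)\<close> and \<open>cost_fun P t\<close> are only applied to two lists of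
  length \<open>Suc t\<close>, the disturbances and the actions up to time \<open>t\<close>;
  \<open>obs_fun P 0\<close> is not used, the initial observation being given by \<open>obs_init P\<close>.
\<close>

record ('o, 'e) uncertain_system =
  Omega :: "'o set"
  dist_set :: "'e set"
  act_set :: "'e set"
  obs_set :: "'e set"
  cost_set :: "real set"
  discount :: real
  disturbance :: "nat \<Rightarrow> 'o \<Rightarrow> 'e"
  obs_init :: "'e \<Rightarrow> 'e"
  obs_fun :: "nat \<Rightarrow> 'e list \<Rightarrow> 'e list \<Rightarrow> 'e"
  cost_fun :: "nat \<Rightarrow> 'e list \<Rightarrow> 'e list \<Rightarrow> real"

type_synonym 'e memory = "'e list \<times> 'e list"

definition tuples :: "nat \<Rightarrow> 'a set \<Rightarrow> 'a list set" where
  "tuples n A = {xs. length xs = n \<and> set xs \<subseteq> A}"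

text \<open>Only finite joint ranges are required to be products.\<close>

definition independent_uvars :: "'o set \<Rightarrow> (nat \<Rightarrow> 'o \<Rightarrow> 'e) \<Rightarrow> bool" where
  "independent_uvars Om X \<longleftrightarrow>
     (\<forall>J. finite J \<and> J \<noteq> {} \<longrightarrow>
        (\<lambda>\<omega>. restrict (\<lambda>t. X t \<omega>) J) ` Om = Pi\<^sub>E J (\<lambda>t. X t ` Om))"

definition valid_system :: "('o, 'e::metric_space) uncertain_system \<Rightarrow> bool" where
  "valid_system P \<longleftrightarrow>
     0 < discount P \<and> discount P < 1 \<and>
     dist_set P \<noteq> {} \<and> bounded (dist_set P) \<and>
     act_set P \<noteq> {} \<and> bounded (act_set P) \<and>
     obs_set P \<noteq> {} \<and> bounded (obs_set P) \<and>
     bounded (cost_set P) \<and> cost_set P \<subseteq> {0..} \<and>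
     Inf (cost_set P) \<in> cost_set P \<and> Sup (cost_set P) \<in> cost_set P \<and>
     (\<forall>t. \<forall>\<omega>\<in>Omega P. disturbance P t \<omega> \<in> dist_set P) \<and>
     independent_uvars (Omega P) (disturbance P) \<and>
     (\<forall>w\<in>dist_set P. obs_init P w \<in> obs_set P) \<and>
     (\<forall>t. \<forall>ws\<in>tuples (Suc t) (dist_set P). \<forall>us\<in>tuples (Suc t) (act_set P).
        obs_fun P (Suc t) ws us \<in> obs_set P \<and> cost_fun P t ws us \<in> cost_set P)"

definition cost_min :: "('o, 'e) uncertain_system \<Rightarrow> real" where
  "cost_min P = Inf (cost_set P)"

definition cost_max :: "('o, 'e) uncertain_system \<Rightarrow> real" where
  "cost_max P = Sup (cost_set P)"

definition accrued_max :: "('o, 'e) uncertain_system \<Rightarrow> real" where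
  "accrued_max P = cost_max P / (1 - discount P)"

definition dist_upto :: "('o, 'e) uncertain_system \<Rightarrow> nat \<Rightarrow> 'o \<Rightarrow> 'e list" where
  "dist_upto P t \<omega> = map (\<lambda>i. disturbance P i \<omega>) [0..<Suc t]"

text \<open>
  Observation, stage cost and accrued cost at a sample, as functions of an action list \<open>us\<close>
  that is at least as long as needed; later actions in \<open>us\<close> are ignored.
\<close>

fun obs_at :: "('o, 'e) uncertain_system \<Rightarrow> nat \<Rightarrow> 'e list \<Rightarrow> 'o \<Rightarrow> 'e" where
  "obs_at P 0 us \<omega> = obs_init P (disturbance P 0 \<omega>)"
| "obs_at P (Suc t) us \<omega> = obs_fun P (Suc t) (dist_upto P t \<omega>) (take (Suc t) us)"

definition cost_at :: "('o, 'e) uncertain_system \<Rightarrow> nat \<Rightarrow> 'e list \<Rightarrow> 'o \<Rightarrow> real" where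
  "cost_at P t us \<omega> = cost_fun P t (dist_upto P t \<omega>) (take (Suc t) us)"

definition accrued :: "('o, 'e) uncertain_system \<Rightarrow> nat \<Rightarrow> 'e list \<Rightarrow> 'o \<Rightarrow> real" where
  "accrued P t us \<omega> = (\<Sum>l<t. discount P ^ l * cost_at P l us \<omega>)"

definition memory_space :: "('o, 'e) uncertain_system \<Rightarrow> nat \<Rightarrow> 'e memory set" where
  "memory_space P t = tuples (Suc t) (obs_set P) \<times> tuples t (act_set P)"

text \<open>The samples over which ranges conditioned on a memory realization are taken.\<close>

definition cond_samples :: "('o, 'e) uncertain_system \<Rightarrow> nat \<Rightarrow> 'e memory \<Rightarrow> 'o set" where
  "cond_samples P t m = {\<omega> \<in> Omega P. \<forall>k\<le>t. obs_at P k (snd m) \<omega> = fst m ! k}"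

definition feasible :: "('o, 'e) uncertain_system \<Rightarrow> nat \<Rightarrow> 'e memory \<Rightarrow> bool" where
  "feasible P t m \<longleftrightarrow> m \<in> memory_space P t \<and> cond_samples P t m \<noteq> {}"

definition strategies :: "('o, 'e) uncertain_system \<Rightarrow> (nat \<Rightarrow> 'e memory \<Rightarrow> 'e) set" where
  "strategies P = {g. \<forall>t. \<forall>m\<in>memory_space P t. g t m \<in> act_set P}"

definition next_memory ::
  "('o, 'e) uncertain_system \<Rightarrow> nat \<Rightarrow> 'e memory \<Rightarrow> 'e \<Rightarrow> 'o \<Rightarrow> 'e memory" where
  "next_memory P t m u \<omega> =
     (fst m @ [obs_at P (Suc t) (snd m @ [u]) \<omega>], snd m @ [u])"

text \<open>The memory at time \<open>t + k\<close> when all actions from time \<open>t\<close> on are generated by \<open>g\<close>.\<close>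

fun run_memory :: "('o, 'e) uncertain_system \<Rightarrow> (nat \<Rightarrow> 'e memory \<Rightarrow> 'e) \<Rightarrow>
    nat \<Rightarrow> 'e memory \<Rightarrow> 'o \<Rightarrow> nat \<Rightarrow> 'e memory" where
  "run_memory P g t m \<omega> 0 = m"
| "run_memory P g t m \<omega> (Suc k) =
     (let m' = run_memory P g t m \<omega> k in next_memory P (t + k) m' (g (t + k) m') \<omega>)"

definition cost_to_go :: "('o, 'e) uncertain_system \<Rightarrow> (nat \<Rightarrow> 'e memory \<Rightarrow> 'e) \<Rightarrow>
    nat \<Rightarrow> 'e memory \<Rightarrow> 'o \<Rightarrow> real" where
  "cost_to_go P g t m \<omega> =
     (\<Sum>k. discount P ^ k * cost_at P (t + k) (snd (run_memory P g t m \<omega> (Suc k))) \<omega>)"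

definition accrued_range :: "('o, 'e) uncertain_system \<Rightarrow> nat \<Rightarrow> 'e memory \<Rightarrow> real set" where
  "accrued_range P t m = accrued P t (snd m) ` cond_samples P t m"

definition accrued_cost_range :: "('o, 'e) uncertain_system \<Rightarrow> (nat \<Rightarrow> 'e memory \<Rightarrow> 'e) \<Rightarrow>
    nat \<Rightarrow> 'e memory \<Rightarrow> (real \<times> real) set" where
  "accrued_cost_range P g t m =
     (\<lambda>\<omega>. (accrued P t (snd m) \<omega>, cost_to_go P g t m \<omega>)) ` cond_samples P t m"

definition strategy_value :: "('o, 'e) uncertain_system \<Rightarrow> (nat \<Rightarrow> 'e memory \<Rightarrow> 'e) \<Rightarrow>
    nat \<Rightarrow> 'e memory \<Rightarrow> ereal" where
  "strategy_value P g t m =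
     (SUP (a, c)\<in>accrued_cost_range P g t m. ereal (a + discount P ^ t * c))"

definition optimal_value :: "('o, 'e) uncertain_system \<Rightarrow> nat \<Rightarrow> 'e memory \<Rightarrow> ereal" where
  "optimal_value P t m = (INF g\<in>strategies P. strategy_value P g t m)"

definition range_indicator :: "'a set \<Rightarrow> 'a \<Rightarrow> ereal" where
  "range_indicator R x = (if x \<in> R then 0 else - \<infinity>)"

text \<open>
  The ranges conditioned on \<open>(m, u)\<close> of \<open>A\<^sub>t\<close> and of the cost at time \<open>t\<close>, the next information
  state and \<open>A\<^sub>t\<close>. The action at time \<open>t\<close> affects neither \<open>A\<^sub>t\<close> nor which samples are compatible.
\<close>

definition accrued_range_act ::
  "('o, 'e) uncertain_system \<Rightarrow> nat \<Rightarrow> 'e memory \<Rightarrow> 'e \<Rightarrow> real set" where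
  "accrued_range_act P t m u = accrued P t (snd m @ [u]) ` cond_samples P t m"

definition joint_range_act :: "('o, 'e) uncertain_system \<Rightarrow> (nat \<Rightarrow> 'e memory \<Rightarrow> 's) \<Rightarrow>
    nat \<Rightarrow> 'e memory \<Rightarrow> 'e \<Rightarrow> ((real \<times> 's) \<times> real) set" where
  "joint_range_act P \<sigma> t m u =
     (\<lambda>\<omega>. ((cost_at P t (snd m @ [u]) \<omega>, \<sigma> (Suc t) (next_memory P t m u \<omega>)),
           accrued P t (snd m @ [u]) \<omega>)) ` cond_samples P t m"

definition accrued_distribution :: "('o, 'e) uncertain_system \<Rightarrow> (nat \<Rightarrow> 'e memory \<Rightarrow> 's) \<Rightarrow>
    nat \<Rightarrow> real \<Rightarrow> 's \<Rightarrow> 'e memory \<Rightarrow> 'e \<Rightarrow> ereal" where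
  "accrued_distribution P \<sigma> t c s' m u =
     (SUP a\<in>{0..accrued_max P}.
        ereal a + range_indicator (joint_range_act P \<sigma> t m u) ((c, s'), a)) -
     (SUP a\<in>{0..accrued_max P}.
        ereal a + range_indicator (accrued_range_act P t m u) a)"

definition cost_distribution :: "('o, 'e) uncertain_system \<Rightarrow> 's set \<Rightarrow>
    (real \<Rightarrow> 's \<Rightarrow> 's \<Rightarrow> 'e \<Rightarrow> ereal) \<Rightarrow> bool" where
  "cost_distribution P S \<rho> \<longleftrightarrow>
     (\<forall>c\<in>cost_set P. \<forall>s'\<in>S. \<forall>s\<in>S. \<forall>u\<in>act_set P.
        \<rho> c s' s u \<in> {- \<infinity>} \<union> {ereal (- accrued_max P)..0}) \<and>
     (\<forall>s\<in>S. \<forall>u\<in>act_set P. (SUP (c, s')\<in>cost_set P \<times> S. \<rho> c s' s u) = 0)"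

definition information_state :: "('o, 'e) uncertain_system \<Rightarrow> 's::metric_space set \<Rightarrow>
    (nat \<Rightarrow> 'e memory \<Rightarrow> 's) \<Rightarrow> (real \<Rightarrow> 's \<Rightarrow> 's \<Rightarrow> 'e \<Rightarrow> ereal) \<Rightarrow> bool" where
  "information_state P S \<sigma> \<rho> \<longleftrightarrow>
     bounded S \<and>
     (\<forall>t m. feasible P t m \<longrightarrow> \<sigma> t m \<in> S) \<and>
     cost_distribution P S \<rho> \<and>
     (\<forall>t m. feasible P t m \<longrightarrow>
        (\<forall>u\<in>act_set P. \<forall>c\<in>cost_set P. \<forall>s'\<in>S.
           accrued_distribution P \<sigma> t c s' m u = \<rho> c s' (\<sigma> t m) u))"

text \<open>
  The operator is given on extended-real functions, so that suprema and infima need no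
  boundedness side conditions; the lemma \<open>bellman_op_bounded\<close> below shows that it maps
  uniformly bounded real functions on \<open>S \<times> (0,1]\<close> to uniformly bounded real functions.
\<close>

definition bellman_op :: "('o, 'e) uncertain_system \<Rightarrow> 's set \<Rightarrow>
    (real \<Rightarrow> 's \<Rightarrow> 's \<Rightarrow> 'e \<Rightarrow> ereal) \<Rightarrow> ('s \<Rightarrow> real \<Rightarrow> ereal) \<Rightarrow> 's \<Rightarrow> real \<Rightarrow> ereal" where
  "bellman_op P S \<rho> L s z =
     (INF u\<in>act_set P. SUP (c, s')\<in>cost_set P \<times> S.
        ereal c + ereal (discount P) * L s' (discount P * z) + \<rho> c s' s u / ereal z)"

definition bellman_iter :: "('o, 'e) uncertain_system \<Rightarrow> 's set \<Rightarrow>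
    (real \<Rightarrow> 's \<Rightarrow> 's \<Rightarrow> 'e \<Rightarrow> ereal) \<Rightarrow> nat \<Rightarrow> 's \<Rightarrow> real \<Rightarrow> ereal" where
  "bellman_iter P S \<rho> n = (bellman_op P S \<rho> ^^ n) (\<lambda>_ _. 0)"

lemma bellman_op_bounded:
  fixes P :: "('o, 'e::metric_space) uncertain_system"
  assumes P: "valid_system P" and \<rho>: "cost_distribution P S \<rho>"
    and B: "\<And>s' z. s' \<in> S \<Longrightarrow> 0 < z \<Longrightarrow> z \<le> 1 \<Longrightarrow> \<bar>\<Lambda> s' z\<bar> \<le> B"
    and s: "s \<in> S" and z: "0 < z" "z \<le> 1"
  shows "\<bar>bellman_op P S \<rho> (\<lambda>s z. ereal (\<Lambda> s z)) s z\<bar> \<le> ereal (cost_max P + discount P * B)"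
proof -
  let ?g = "discount P"
  let ?f = "\<lambda>u c s'. ereal c + ereal ?g * ereal (\<Lambda> s' (?g * z)) + \<rho> c s' s u / ereal z"
  have g: "0 < ?g" "?g < 1" using P by (auto simp: valid_system_def)
  have gz: "0 < ?g * z" "?g * z \<le> 1"
    using g z by (auto intro: mult_le_one)
  have bd: "bdd_above (cost_set P)" "bdd_below (cost_set P)"
    using P by (auto simp: valid_system_def bounded_imp_bdd_above bounded_imp_bdd_below)
  have C: "0 \<le> c" "c \<le> cost_max P" if "c \<in> cost_set P" for c
    using that P bd by (auto simp: valid_system_def cost_max_def intro: cSup_upper)
  have L: "- B \<le> \<Lambda> s' (?g * z)" "\<Lambda> s' (?g * z) \<le> B" if "s' \<in> S" for s'
    using B[OF that gz] by auto
  have gL: "- (?g * B) \<le> ?g * \<Lambda> s' (?g * z)" "?g * \<Lambda> s' (?g * z) \<le> ?g * B" if "s' \<in> S" for s'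
    using mult_left_mono[OF L(1)[OF that], of ?g] mult_left_mono[OF L(2)[OF that], of ?g] g by auto
  obtain u0 where u0: "u0 \<in> act_set P" using P unfolding valid_system_def by blast
  have "cost_max P \<in> cost_set P" using P by (simp add: valid_system_def cost_max_def)
  hence c0: "cost_max P \<ge> 0" by (rule C(1))
  have r0: "\<rho> c s' s u \<le> 0" if "u \<in> act_set P" "c \<in> cost_set P" "s' \<in> S" for u c s'
  proof -
    have "\<rho> c s' s u \<in> {- \<infinity>} \<union> {ereal (- accrued_max P)..0}"
      using \<rho> that s unfolding cost_distribution_def by blast
    thus ?thesis by auto
  qed
  have up: "?f u c s' \<le> ereal (cost_max P + ?g * B)"
    if "u \<in> act_set P" "c \<in> cost_set P" "s' \<in> S" for u c s'
  proof -
    have r: "\<rho> c s' s u / ereal z \<le> 0"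
      using z r0[OF that] by (cases "\<rho> c s' s u") (auto simp: divide_le_0_iff)
    have "ereal c + ereal ?g * ereal (\<Lambda> s' (?g * z)) \<le> ereal (cost_max P + ?g * B)"
      using C(2)[OF that(2)] gL(2)[OF that(3)] by simp
    from add_mono[OF this r] show ?thesis by simp
  qed
  have lo: "ereal (- (?g * B)) \<le> (SUP (c, s')\<in>cost_set P \<times> S. ?f u c s')"
    if u: "u \<in> act_set P" for u
  proof (rule ereal_le_epsilon2)
    fix e :: real assume e: "0 < e"
    have "(SUP (c, s')\<in>cost_set P \<times> S. \<rho> c s' s u) = 0"
      using \<rho> s u by (auto simp: cost_distribution_def)
    moreover have "ereal (- (e * z)) < 0" using e z by simp
    ultimately have "ereal (- (e * z)) < (SUP (c, s')\<in>cost_set P \<times> S. \<rho> c s' s u)" by simp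
    then obtain c s' where cs: "c \<in> cost_set P" "s' \<in> S" "ereal (- (e * z)) < \<rho> c s' s u"
      unfolding less_SUP_iff by auto
    obtain x where x: "\<rho> c s' s u = ereal x" using cs(3) r0[OF u cs(1,2)] by (cases "\<rho> c s' s u") auto
    have "- e \<le> x / z" using cs(3) x z by (simp add: field_simps)
    hence "ereal (- (?g * B)) \<le> ?f u c s' + ereal e"
      using C(1)[OF cs(1)] gL(1)[OF cs(2)] x z by simp
    also have "\<dots> \<le> (SUP (c, s')\<in>cost_set P \<times> S. ?f u c s') + ereal e"
      using cs by (intro add_right_mono SUP_upper2[of "(c, s')"]) auto
    finally show "ereal (- (?g * B)) \<le> (SUP (c, s')\<in>cost_set P \<times> S. ?f u c s') + ereal e" .
  qed
  have "bellman_op P S \<rho> (\<lambda>s z. ereal (\<Lambda> s z)) s z \<le> ereal (cost_max P + ?g * B)"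
    unfolding bellman_op_def using up[OF u0]
    by (intro INF_lower2[OF u0] SUP_least) auto
  moreover have "ereal (- (cost_max P + ?g * B)) \<le> bellman_op P S \<rho> (\<lambda>s z. ereal (\<Lambda> s z)) s z"
    unfolding bellman_op_def
  proof (rule INF_greatest)
    fix u assume "u \<in> act_set P"
    have "ereal (- (cost_max P + ?g * B)) \<le> ereal (- (?g * B))" using c0 by simp
    also note lo[OF \<open>u \<in> act_set P\<close>]
    finally show "ereal (- (cost_max P + ?g * B)) \<le> (SUP (c, s')\<in>cost_set P \<times> S. ?f u c s')" .
  qed
  ultimately show ?thesis
    by (cases "bellman_op P S \<rho> (\<lambda>s z. ereal (\<Lambda> s z)) s z") auto
qed

end

theory Submission
  imports Defs
begin

text \<open>
  Write \<open>\<alpha>\<^sub>t(m)\<close> for the largest accrued cost compatible with the memory \<open>m\<close>, and let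
  \<open>J\<^sub>n(t, m) = \<alpha>\<^sub>t(m) + \<gamma>\<^sup>t \<Lambda>\<^sup>n(\<sigma>\<^sub>t(m), \<gamma>\<^sup>t)\<close>, the middle term of both inequalities
  (\<open>horizon_value\<close> below). The claim is that the optimal value exceeds \<open>J\<^sub>n(t, m)\<close> by a quantity
  between the extreme total discounted costs after time \<open>t + n\<close>.

  The heart of the proof is that \<open>J\<close> satisfies the dynamic programming recursion on memories,
  \<open>J\<^sub>n\<^sub>+\<^sub>1(t, m) = inf\<^sub>u sup\<^sub>\<omega> J\<^sub>n(t + 1, m')\<close>, where \<open>m'\<close> is the memory that follows \<open>m\<close> under
  the action \<open>u\<close> and the sample \<open>\<omega>\<close> (\<open>horizon_value_Suc\<close>). The accrued distribution was made
  for this: by definition, \<open>\<alpha>\<^sub>t(m) + \<rho>(c, s' | \<sigma>\<^sub>t(m), u)\<close> is the largest accrued cost among those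
  samples compatible with \<open>m\<close> that yield the stage cost \<open>c\<close> and the next information state \<open>s'\<close>.
  Multiplying the Bellman operator at \<open>z = \<gamma>\<^sup>t\<close> by \<open>\<gamma>\<^sup>t\<close> cancels the division of \<open>\<rho>\<close> by \<open>z\<close>, so
  its supremum over \<open>(c, s')\<close> becomes a supremum over all compatible samples of
  \<open>A\<^sub>t + \<gamma>\<^sup>t C\<^sub>t + \<gamma>\<^sup>t\<^sup>+\<^sup>1 \<Lambda>\<^sup>n(S\<^sub>t\<^sub>+\<^sub>1, \<gamma>\<^sup>t\<^sup>+\<^sup>1)\<close>. Here \<open>A\<^sub>t + \<gamma>\<^sup>t C\<^sub>t = A\<^sub>t\<^sub>+\<^sub>1\<close>; grouping the samples
  by the next memory turns this into the supremum of \<open>J\<^sub>n(t + 1, m')\<close>.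

  The value of a strategy satisfies the analogous recursion, in which the infimum over \<open>u\<close> is
  replaced by the action of the strategy (\<open>strategy_value_Suc\<close>). An induction on \<open>n\<close> compares the two
  recursions. Any strategy does at least as badly as the infimum, which gives the lower bound
  for all strategies at once. For the upper bound it is enough to exhibit one good strategy up
  to an error: up to time \<open>t + n\<close> it attains the infimum for the remaining horizon up to a
  constant, so the errors add up to \<open>n\<close> times that constant. Both inductions start at horizon \<open>0\<close>,
  where only the trivial bounds on the cost-to-go are used.
\<close>

section \<open>Extended-real suprema and infima\<close>

text \<open>
  Multiplication by a positive real and addition of a real are order automorphisms of the
  extended reals, hence commute with every supremum and infimum, even over an empty index set.
\<close>

lemma bij_ereal_affine:
  fixes a z :: real
  assumes "0 < z"
  shows "bij (\<lambda>x. ereal a + ereal z * x)"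
proof (rule o_bij)
  let ?h = "\<lambda>y. ereal (1 / z) * (y - ereal a)"
  show "?h \<circ> (\<lambda>x. ereal a + ereal z * x) = id"
  proof
    fix x show "(?h \<circ> (\<lambda>x. ereal a + ereal z * x)) x = id x"
      using assms by (cases x) auto
  qed
  show "(\<lambda>x. ereal a + ereal z * x) \<circ> ?h = id"
  proof
    fix x show "((\<lambda>x. ereal a + ereal z * x) \<circ> ?h) x = id x"
      using assms by (cases x) auto
  qed
qed

lemma mono_ereal_affine:
  fixes a z :: real
  assumes "0 < z"
  shows "mono (\<lambda>x. ereal a + ereal z * x)"
  using assms by (intro monoI add_left_mono ereal_mult_left_mono) auto

lemma ereal_affine_INF:
  fixes a z :: real
  assumes "0 < z"
  shows "ereal a + ereal z * (INF i\<in>I. f i) = (INF i\<in>I. ereal a + ereal z * f i)"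
  using mono_bij_Inf[OF mono_ereal_affine[OF assms, of a] bij_ereal_affine[OF assms, of a], of "f ` I"]
  by (simp add: image_image)

lemma mono_bij_Sup:
  fixes f :: "'a::complete_linorder \<Rightarrow> 'b::complete_linorder"
  assumes "mono f" "bij f"
  shows "f (Sup A) = Sup (f ` A)"
proof (rule antisym)
  \<comment> \<open>The supremum of the image has a preimage, and it is an upper bound because \<open>f\<close> reflects the order.\<close>
  obtain b where b: "f b = Sup (f ` A)"
    using bij_is_surj[OF assms(2)] by (metis surjD)
  have "a \<le> b" if "a \<in> A" for a
  proof (rule ccontr)
    assume "\<not> a \<le> b"
    then have "f b \<le> f a" "a \<noteq> b" using assms(1) by (auto simp: monoD)
    moreover have "f a \<le> f b" unfolding b using that by (intro Sup_upper) simp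
    ultimately show False using bij_is_inj[OF assms(2)] by (auto dest: injD)
  qed
  then show "f (Sup A) \<le> Sup (f ` A)"
    unfolding b[symmetric] by (intro monoD[OF assms(1)] Sup_least)
  show "Sup (f ` A) \<le> f (Sup A)"
    by (rule mono_Sup[OF assms(1)])
qed

lemma ereal_affine_SUP:
  fixes a z :: real
  assumes "0 < z"
  shows "ereal a + ereal z * (SUP i\<in>I. f i) = (SUP i\<in>I. ereal a + ereal z * f i)"
  using mono_bij_Sup[OF mono_ereal_affine[OF assms, of a] bij_ereal_affine[OF assms, of a], of "f ` I"]
  by (simp add: image_image)

lemma ereal_add_SUP:
  fixes a :: real
  shows "ereal a + (SUP i\<in>I. f i) = (SUP i\<in>I. ereal a + f i)"
  using ereal_affine_SUP[of 1 a f I] by (simp flip: one_ereal_def)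

text \<open>Outside the range, the indicator makes the term \<open>-\<infinity>\<close>, which a supremum ignores.\<close>

lemma SUP_add_range_indicator:
  "(SUP a\<in>I. ereal a + range_indicator R (f a)) = (SUP a\<in>{a \<in> I. f a \<in> R}. ereal a)"
proof (rule antisym)
  show "(SUP a\<in>I. ereal a + range_indicator R (f a)) \<le> (SUP a\<in>{a \<in> I. f a \<in> R}. ereal a)"
  proof (rule SUP_least)
    fix a assume "a \<in> I"
    then show "ereal a + range_indicator R (f a) \<le> (SUP a\<in>{a \<in> I. f a \<in> R}. ereal a)"
      by (cases "f a \<in> R") (auto simp: range_indicator_def intro: SUP_upper)
  qed
  show "(SUP a\<in>{a \<in> I. f a \<in> R}. ereal a) \<le> (SUP a\<in>I. ereal a + range_indicator R (f a))"
  proof (rule SUP_least)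
    fix a assume a: "a \<in> {a \<in> I. f a \<in> R}"
    then have "ereal a = ereal a + range_indicator R (f a)"
      by (simp add: range_indicator_def)
    also have "\<dots> \<le> (SUP a\<in>I. ereal a + range_indicator R (f a))"
      using a by (intro SUP_upper) simp
    finally show "ereal a \<le> (SUP a\<in>I. ereal a + range_indicator R (f a))" .
  qed
qed

lemma SUP_by_values:
  fixes f :: "'a \<Rightarrow> 'b::complete_lattice"
  assumes "p ` X \<subseteq> Q"
  shows "(SUP q\<in>Q. SUP x\<in>{x \<in> X. p x = q}. f x) = (SUP x\<in>X. f x)"
proof (rule antisym)
  show "(SUP q\<in>Q. SUP x\<in>{x \<in> X. p x = q}. f x) \<le> (SUP x\<in>X. f x)"
    by (intro SUP_least SUP_upper) simp
  show "(SUP x\<in>X. f x) \<le> (SUP q\<in>Q. SUP x\<in>{x \<in> X. p x = q}. f x)"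
  proof (rule SUP_least)
    fix x assume x: "x \<in> X"
    then have "f x \<le> (SUP y\<in>{y \<in> X. p y = p x}. f y)"
      by (intro SUP_upper) simp
    also have "\<dots> \<le> (SUP q\<in>Q. SUP x\<in>{x \<in> X. p x = q}. f x)"
      using assms x by (intro SUP_upper) auto
    finally show "f x \<le> (SUP q\<in>Q. SUP x\<in>{x \<in> X. p x = q}. f x)" .
  qed
qed

lemma SUP_fibres:
  fixes f :: "'a \<Rightarrow> 'b::complete_lattice"
  shows "(SUP x\<in>X. SUP y\<in>{y \<in> X. p y = p x}. f y) = (SUP x\<in>X. f x)"
  using SUP_by_values[of p X "p ` X" f] by (simp add: image_image)

section \<open>Trajectories\<close>

locale controlled_system =
  fixes P :: "('o, 'e::metric_space) uncertain_system"
  assumes valid: "valid_system P"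
begin

abbreviation \<gamma> where "\<gamma> \<equiv> discount P"

lemma discount_bounds: "0 < \<gamma>" "\<gamma> < 1"
  using valid by (auto simp: valid_system_def)

lemma cost_bounds:
  assumes "c \<in> cost_set P"
  shows "0 \<le> c" "cost_min P \<le> c" "c \<le> cost_max P"
  using assms valid
  by (auto simp: valid_system_def cost_min_def cost_max_def bounded_imp_bdd_above
      bounded_imp_bdd_below intro: cInf_lower cSup_upper)

lemma act_set_nonempty: "act_set P \<noteq> {}"
  using valid by (simp add: valid_system_def)

lemma dist_upto_tuples: "\<omega> \<in> Omega P \<Longrightarrow> dist_upto P t \<omega> \<in> tuples (Suc t) (dist_set P)"
  using valid by (auto simp: valid_system_def dist_upto_def tuples_def)

lemma obs_at_in:
  assumes "\<omega> \<in> Omega P" "set us \<subseteq> act_set P" "t \<le> length us"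
  shows "obs_at P t us \<omega> \<in> obs_set P"
proof (cases t)
  case 0
  then show ?thesis using valid assms by (auto simp: valid_system_def)
next
  case (Suc k)
  have "take (Suc k) us \<in> tuples (Suc k) (act_set P)"
    using assms Suc by (auto simp: tuples_def dest: in_set_takeD)
  then show ?thesis
    using valid dist_upto_tuples[OF assms(1), of k] Suc by (simp add: valid_system_def)
qed

lemma cost_at_in:
  assumes "\<omega> \<in> Omega P" "set us \<subseteq> act_set P" "t < length us"
  shows "cost_at P t us \<omega> \<in> cost_set P"
proof -
  have "take (Suc t) us \<in> tuples (Suc t) (act_set P)"
    using assms by (auto simp: tuples_def dest: in_set_takeD)
  then show ?thesis
    using valid dist_upto_tuples[OF assms(1), of t] by (simp add: valid_system_def cost_at_def)
qed

lemma obs_at_snoc: "k \<le> length us \<Longrightarrow> obs_at P k (us @ [u]) \<omega> = obs_at P k us \<omega>"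
  by (cases k) auto

lemma accrued_snoc: "t \<le> length us \<Longrightarrow> accrued P t (us @ [u]) \<omega> = accrued P t us \<omega>"
  by (auto simp: accrued_def cost_at_def intro!: sum.cong)

lemma accrued_Suc: "accrued P (Suc t) us \<omega> = accrued P t us \<omega> + \<gamma> ^ t * cost_at P t us \<omega>"
  by (simp add: accrued_def)

text \<open>Comparison with the geometric series.\<close>

lemma discounted_sum_bounds:
  assumes "\<And>k. lo \<le> c k" "\<And>k. c k \<le> hi"
  shows "summable (\<lambda>k. \<gamma> ^ k * c k)"
    and "lo / (1 - \<gamma>) \<le> (\<Sum>k. \<gamma> ^ k * c k)"
    and "(\<Sum>k. \<gamma> ^ k * c k) \<le> hi / (1 - \<gamma>)"
proof -
  have g: "norm \<gamma> < 1" using discount_bounds by simp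
  have geo: "(\<lambda>k. \<gamma> ^ k * b) sums (b / (1 - \<gamma>))" for b
    using sums_mult2[OF geometric_sums[OF g], of b] by simp
  have "\<bar>c k\<bar> \<le> \<bar>lo\<bar> + \<bar>hi\<bar>" for k using assms[of k] by linarith
  then show s: "summable (\<lambda>k. \<gamma> ^ k * c k)"
    using discount_bounds
    by (intro summable_comparison_test'[OF sums_summable[OF geo[of "\<bar>lo\<bar> + \<bar>hi\<bar>"]], of 0])
      (auto simp: abs_mult intro!: mult_left_mono)
  have nn: "0 \<le> \<gamma> ^ k" for k using discount_bounds by simp
  show "lo / (1 - \<gamma>) \<le> (\<Sum>k. \<gamma> ^ k * c k)"
    using assms nn by (intro sums_le[OF _ geo summable_sums[OF s]] mult_left_mono)
  show "(\<Sum>k. \<gamma> ^ k * c k) \<le> hi / (1 - \<gamma>)"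
    using assms nn by (intro sums_le[OF _ summable_sums[OF s] geo] mult_left_mono)
qed

lemma memory_spaceD:
  assumes "m \<in> memory_space P t"
  shows "length (fst m) = Suc t" "length (snd m) = t" "set (snd m) \<subseteq> act_set P"
  using assms by (auto simp: memory_space_def tuples_def)

lemma next_memory_in:
  assumes "m \<in> memory_space P t" "u \<in> act_set P" "\<omega> \<in> Omega P"
  shows "next_memory P t m u \<omega> \<in> memory_space P (Suc t)"
  using assms obs_at_in[OF assms(3), of "snd m @ [u]" "Suc t"]
  by (auto simp: memory_space_def tuples_def next_memory_def)

text \<open>
  Samples compatible with \<open>m\<close> already agree with the observations up to time \<open>t\<close>, so
  compatibility with the next memory only adds that the new observation agrees. Hence the samples
  compatible with \<open>m\<close> are partitioned by the next memory, which is what allows suprema over them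
  to be taken in two stages.
\<close>

lemma cond_samples_next_memory:
  assumes "m \<in> memory_space P t"
  shows "cond_samples P (Suc t) (next_memory P t m u \<omega>) =
    {\<omega>' \<in> cond_samples P t m. next_memory P t m u \<omega>' = next_memory P t m u \<omega>}"
  using memory_spaceD[OF assms]
  by (auto simp: cond_samples_def next_memory_def nth_append le_Suc_eq obs_at_snoc
      simp del: obs_at.simps)

lemma feasible_next_memory:
  assumes "feasible P t m" "u \<in> act_set P" "\<omega> \<in> cond_samples P t m"
  shows "feasible P (Suc t) (next_memory P t m u \<omega>)"
  using assms next_memory_in[of m t u \<omega>] cond_samples_next_memory[of m t u \<omega>]
  by (auto simp: feasible_def cond_samples_def)

lemma accrued_bounds:
  assumes "\<omega> \<in> Omega P" "set us \<subseteq> act_set P" "t \<le> length us"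
  shows "accrued P t us \<omega> \<in> {0..accrued_max P}"
proof -
  \<comment> \<open>A finite discounted sum is an infinite one padded with zeros, and \<open>0\<close> lies between \<open>0\<close> and \<open>cost_max\<close>.\<close>
  let ?c = "\<lambda>l. if l < t then cost_at P l us \<omega> else 0"
  have C: "0 \<le> cost_at P l us \<omega>" "cost_at P l us \<omega> \<le> cost_max P" if "l < t" for l
    using cost_bounds cost_at_in[OF assms(1,2), of l] assms(3) that by auto
  have M: "0 \<le> cost_max P"
    using valid by (auto simp: valid_system_def cost_max_def)
  have "(\<Sum>l. \<gamma> ^ l * ?c l) = (\<Sum>l<t. \<gamma> ^ l * ?c l)"
    by (rule suminf_finite) auto
  also have "\<dots> = accrued P t us \<omega>"
    by (simp add: accrued_def)
  finally show ?thesis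
    using discounted_sum_bounds(2,3)[of 0 ?c "cost_max P"] C M
    by (auto simp: accrued_max_def)
qed

section \<open>The value of a strategy\<close>

lemma strategiesD: "g \<in> strategies P \<Longrightarrow> m \<in> memory_space P t \<Longrightarrow> g t m \<in> act_set P"
  by (auto simp: strategies_def)

lemma run_memory_in:
  assumes "g \<in> strategies P" "m \<in> memory_space P t" "\<omega> \<in> Omega P"
  shows "run_memory P g t m \<omega> k \<in> memory_space P (t + k)"
  by (induction k) (auto simp: Let_def assms intro!: next_memory_in strategiesD)

text \<open>
  The recursion defining the run adds its last step, whereas dynamic programming splits off the
  first one.
\<close>

lemma run_memory_Suc_shift:
  "run_memory P g t m \<omega> (Suc k) =
     run_memory P g (Suc t) (next_memory P t m (g t m) \<omega>) \<omega> k"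
  by (induction k) (auto simp: Let_def)

lemma stage_cost_in:
  assumes "g \<in> strategies P" "m \<in> memory_space P t" "\<omega> \<in> Omega P"
  shows "cost_at P (t + k) (snd (run_memory P g t m \<omega> (Suc k))) \<omega> \<in> cost_set P"
  using memory_spaceD[OF run_memory_in[OF assms, of "Suc k"]]
  by (intro cost_at_in assms) auto

lemma cost_to_go_bounds:
  assumes "g \<in> strategies P" "m \<in> memory_space P t" "\<omega> \<in> Omega P"
  shows "cost_min P / (1 - \<gamma>) \<le> cost_to_go P g t m \<omega>"
    and "cost_to_go P g t m \<omega> \<le> cost_max P / (1 - \<gamma>)"
  unfolding cost_to_go_def
  by (rule discounted_sum_bounds cost_bounds stage_cost_in assms)+

lemma cost_to_go_Suc:
  assumes "g \<in> strategies P" "m \<in> memory_space P t" "\<omega> \<in> Omega P"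
  shows "cost_to_go P g t m \<omega> = cost_at P t (snd m @ [g t m]) \<omega>
    + \<gamma> * cost_to_go P g (Suc t) (next_memory P t m (g t m) \<omega>) \<omega>"
proof -
  let ?c = "\<lambda>k. cost_at P (t + k) (snd (run_memory P g t m \<omega> (Suc k))) \<omega>"
  let ?m = "next_memory P t m (g t m) \<omega>"
  have m': "?m \<in> memory_space P (Suc t)"
    by (intro next_memory_in strategiesD assms)
  have tail: "?c (Suc k) = cost_at P (Suc t + k) (snd (run_memory P g (Suc t) ?m \<omega> (Suc k))) \<omega>" for k
    using run_memory_Suc_shift[of g t m \<omega> "Suc k"] by simp
  have "summable (\<lambda>k. \<gamma> ^ k * ?c k)"
    by (rule discounted_sum_bounds cost_bounds stage_cost_in assms)+
  from suminf_split_head[OF this]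
  have "(\<Sum>k. \<gamma> ^ k * ?c k) = ?c 0 + (\<Sum>k. \<gamma> ^ Suc k * ?c (Suc k))"
    by (simp only: power_0 mult_1 diff_eq_eq add.commute)
  also have "(\<Sum>k. \<gamma> ^ Suc k * ?c (Suc k)) =
      (\<Sum>k. \<gamma> * (\<gamma> ^ k * cost_at P (Suc t + k) (snd (run_memory P g (Suc t) ?m \<omega> (Suc k))) \<omega>))"
    unfolding tail by (simp add: mult.assoc)
  also have "\<dots> = \<gamma> * cost_to_go P g (Suc t) ?m \<omega>"
    unfolding cost_to_go_def
    by (intro suminf_mult) (rule discounted_sum_bounds cost_bounds stage_cost_in assms m')+
  finally show ?thesis
    by (simp add: cost_to_go_def next_memory_def)
qed

lemma strategy_value_alt:
  "strategy_value P g t m =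
     (SUP \<omega>\<in>cond_samples P t m. ereal (accrued P t (snd m) \<omega> + \<gamma> ^ t * cost_to_go P g t m \<omega>))"
  by (simp add: strategy_value_def accrued_cost_range_def image_image)

text \<open>
  The total cost along a sample can be split at \<open>t\<close> or at \<open>t + 1\<close>:
  \<open>A\<^sub>t + \<gamma>\<^sup>t C\<^sub>t\<^sup>\<infinity> = A\<^sub>t\<^sub>+\<^sub>1 + \<gamma>\<^sup>t\<^sup>+\<^sup>1 C\<^sub>t\<^sub>+\<^sub>1\<^sup>\<infinity>\<close>. So the two values are suprema of the same
  function, over all compatible samples and over the fibres of the next memory.
\<close>

lemma strategy_value_Suc:
  assumes g: "g \<in> strategies P" and m: "m \<in> memory_space P t"
  shows "strategy_value P g t m =
    (SUP \<omega>\<in>cond_samples P t m. strategy_value P g (Suc t) (next_memory P t m (g t m) \<omega>))"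
proof -
  let ?m = "next_memory P t m (g t m)"
  let ?f = "\<lambda>\<omega>. ereal (accrued P t (snd m) \<omega> + \<gamma> ^ t * cost_to_go P g t m \<omega>)"
  have "strategy_value P g (Suc t) (?m \<omega>) =
      (SUP \<omega>'\<in>{\<omega>' \<in> cond_samples P t m. ?m \<omega>' = ?m \<omega>}. ?f \<omega>')" for \<omega>
    unfolding strategy_value_alt cond_samples_next_memory[OF m]
  proof (rule SUP_cong[OF refl])
    fix \<omega>' assume w: "\<omega>' \<in> {\<omega>' \<in> cond_samples P t m. ?m \<omega>' = ?m \<omega>}"
    have us: "snd (?m \<omega>) = snd m @ [g t m]" by (simp add: next_memory_def)
    have "cost_to_go P g t m \<omega>' = cost_at P t (snd m @ [g t m]) \<omega>' + \<gamma> * cost_to_go P g (Suc t) (?m \<omega>) \<omega>'"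
      using cost_to_go_Suc[OF g m, of \<omega>'] w by (simp add: cond_samples_def)
    then show "ereal (accrued P (Suc t) (snd (?m \<omega>)) \<omega>' + \<gamma> ^ Suc t * cost_to_go P g (Suc t) (?m \<omega>) \<omega>') = ?f \<omega>'"
      using memory_spaceD(2)[OF m] by (simp add: us accrued_Suc accrued_snoc algebra_simps)
  qed
  then show ?thesis by (simp add: strategy_value_alt[of g t m] SUP_fibres)
qed

abbreviation accrued_sup :: "nat \<Rightarrow> 'e memory \<Rightarrow> ereal" where
  "accrued_sup t m \<equiv> (SUP a\<in>accrued_range P t m. ereal a)"

lemma accrued_sup_alt:
  "accrued_sup t m = (SUP \<omega>\<in>cond_samples P t m. ereal (accrued P t (snd m) \<omega>))"
  by (simp add: accrued_range_def image_image)

lemma accrued_in: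
  assumes "m \<in> memory_space P t" "\<omega> \<in> cond_samples P t m"
  shows "accrued P t (snd m) \<omega> \<in> {0..accrued_max P}"
  using memory_spaceD[OF assms(1)] assms(2)
  by (intro accrued_bounds) (auto simp: cond_samples_def)

lemma accrued_sup_finite:
  assumes "feasible P t m"
  obtains a where "accrued_sup t m = ereal a"
proof -
  obtain \<omega> where w: "\<omega> \<in> cond_samples P t m" and m: "m \<in> memory_space P t"
    using assms by (auto simp: feasible_def)
  have "ereal (accrued P t (snd m) \<omega>) \<le> accrued_sup t m"
    unfolding accrued_sup_alt using w by (rule SUP_upper)
  moreover have "accrued_sup t m \<le> ereal (accrued_max P)"
    unfolding accrued_sup_alt using accrued_in[OF m] by (auto intro!: SUP_least)
  ultimately show ?thesis using that by (cases "accrued_sup t m") auto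
qed

lemma strategy_value_bounds:
  assumes g: "g \<in> strategies P" and m: "m \<in> memory_space P t"
  shows "ereal (\<gamma> ^ t * cost_min P / (1 - \<gamma>)) + accrued_sup t m \<le> strategy_value P g t m"
    and "strategy_value P g t m \<le> ereal (\<gamma> ^ t * cost_max P / (1 - \<gamma>)) + accrued_sup t m"
proof -
  have nn: "0 \<le> \<gamma> ^ t" using discount_bounds by simp
  have b: "\<gamma> ^ t * cost_min P / (1 - \<gamma>) \<le> \<gamma> ^ t * cost_to_go P g t m \<omega>"
    "\<gamma> ^ t * cost_to_go P g t m \<omega> \<le> \<gamma> ^ t * cost_max P / (1 - \<gamma>)"
    if "\<omega> \<in> cond_samples P t m" for \<omega>
    using that mult_left_mono[OF cost_to_go_bounds(1)[OF g m, of \<omega>] nn]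
      mult_left_mono[OF cost_to_go_bounds(2)[OF g m, of \<omega>] nn]
    by (auto simp: cond_samples_def)
  show "ereal (\<gamma> ^ t * cost_min P / (1 - \<gamma>)) + accrued_sup t m \<le> strategy_value P g t m"
    unfolding accrued_sup_alt strategy_value_alt ereal_add_SUP
    using b by (intro SUP_subset_mono[OF subset_refl]) auto
  show "strategy_value P g t m \<le> ereal (\<gamma> ^ t * cost_max P / (1 - \<gamma>)) + accrued_sup t m"
    unfolding accrued_sup_alt strategy_value_alt ereal_add_SUP
    using b by (intro SUP_subset_mono[OF subset_refl]) auto
qed

end

section \<open>The finite-horizon recursion\<close>

locale information_state_system = controlled_system P
  for P :: "('o, 'e::metric_space) uncertain_system" +
  fixes S :: "'s::metric_space set"
    and \<sigma> :: "nat \<Rightarrow> 'e memory \<Rightarrow> 's"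
    and \<rho> :: "real \<Rightarrow> 's \<Rightarrow> 's \<Rightarrow> 'e \<Rightarrow> ereal"
  assumes info: "information_state P S \<sigma> \<rho>"
begin

lemma cost_distr: "cost_distribution P S \<rho>"
  using info by (simp add: information_state_def)

lemma state_in: "feasible P t m \<Longrightarrow> \<sigma> t m \<in> S"
  using info unfolding information_state_def by blast

lemma bellman_iter_Suc: "bellman_iter P S \<rho> (Suc n) = bellman_op P S \<rho> (bellman_iter P S \<rho> n)"
  by (simp add: bellman_iter_def)

text \<open>
  Finiteness of the iterates is needed because extended-real addition does not cancel or
  distribute freely at infinite values. A uniform bound is what the operator preserves.
\<close>

lemma bellman_iter_bounded:
  "\<exists>B. \<forall>s\<in>S. \<forall>z. 0 < z \<and> z \<le> 1 \<longrightarrow> \<bar>bellman_iter P S \<rho> n s z\<bar> \<le> ereal B"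
proof (induction n)
  case 0
  then show ?case by (auto simp: bellman_iter_def intro!: exI[of _ 0])
next
  case (Suc n)
  let ?L = "bellman_iter P S \<rho> n"
  from Suc obtain B where B: "\<And>s z. s \<in> S \<Longrightarrow> 0 < z \<Longrightarrow> z \<le> 1 \<Longrightarrow> \<bar>?L s z\<bar> \<le> ereal B"
    by blast
  have "\<exists>x. ?L s z = ereal x \<and> \<bar>x\<bar> \<le> B" if "s \<in> S" "0 < z" "z \<le> 1" for s z
    using B[OF that] by (cases "?L s z") simp_all
  then obtain R where R: "\<And>s z. s \<in> S \<Longrightarrow> 0 < z \<Longrightarrow> z \<le> 1 \<Longrightarrow> ?L s z = ereal (R s z)"
      "\<And>s z. s \<in> S \<Longrightarrow> 0 < z \<Longrightarrow> z \<le> 1 \<Longrightarrow> \<bar>R s z\<bar> \<le> B"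
    by metis
  have "\<bar>bellman_iter P S \<rho> (Suc n) s z\<bar> \<le> ereal (cost_max P + \<gamma> * B)"
    if "s \<in> S" "0 < z" "z \<le> 1" for s z
  proof -
    have gz: "0 < \<gamma> * z" "\<gamma> * z \<le> 1"
      using discount_bounds that by (auto intro: mult_le_one)
    have "bellman_op P S \<rho> ?L s z = bellman_op P S \<rho> (\<lambda>s z. ereal (R s z)) s z"
      unfolding bellman_op_def
      by (intro INF_cong SUP_cong refl) (auto simp: R(1)[OF _ gz])
    then show ?thesis
      using bellman_op_bounded[OF valid cost_distr R(2) that] by (simp add: bellman_iter_Suc)
  qed
  then show ?case by blast
qed

lemma bellman_iter_finite:
  assumes "s \<in> S" "0 < z" "z \<le> 1"
  obtains x where "bellman_iter P S \<rho> n s z = ereal x"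
  using bellman_iter_bounded[of n] assms by (cases "bellman_iter P S \<rho> n s z") force+

text \<open>
  At feasible memories, by the recursion below, this is the infimum over all strategies of the
  worst-case cost accrued up to time \<open>t + n\<close>, given the memory \<open>m\<close> at time \<open>t\<close>.
\<close>

definition horizon_value :: "nat \<Rightarrow> nat \<Rightarrow> 'e memory \<Rightarrow> ereal" where
  "horizon_value n t m =
     accrued_sup t m + ereal (\<gamma> ^ t) * bellman_iter P S \<rho> n (\<sigma> t m) (\<gamma> ^ t)"

lemma horizon_value_0: "horizon_value 0 t m = accrued_sup t m"
  by (simp add: horizon_value_def bellman_iter_def)

lemma discount_power_bounds: "0 < \<gamma> ^ t" "\<gamma> ^ t \<le> 1"
  using discount_bounds by (auto intro: power_le_one)

lemma horizon_value_finite: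
  assumes "feasible P t m"
  obtains x where "horizon_value n t m = ereal x"
proof -
  obtain a where a: "accrued_sup t m = ereal a" by (rule accrued_sup_finite[OF assms])
  obtain x where "bellman_iter P S \<rho> n (\<sigma> t m) (\<gamma> ^ t) = ereal x"
    by (rule bellman_iter_finite[OF state_in[OF assms] discount_power_bounds])
  with a show ?thesis using that by (simp add: horizon_value_def)
qed

text \<open>
  The second supremum in the accrued distribution is a normalization by \<open>accrued_sup\<close>, so adding
  \<open>accrued_sup\<close> undoes it. It is through this equation that the defining property of an
  information state enters.
\<close>

lemma accrued_sup_plus_cost_distribution:
  assumes m: "feasible P t m" and u: "u \<in> act_set P" and c: "c \<in> cost_set P" and s': "s' \<in> S"
  shows "accrued_sup t m + \<rho> c s' (\<sigma> t m) u =
    (SUP \<omega>\<in>{\<omega> \<in> cond_samples P t m. cost_at P t (snd m @ [u]) \<omega> = c \<and>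
        \<sigma> (Suc t) (next_memory P t m u \<omega>) = s'}. ereal (accrued P t (snd m) \<omega>))"
proof -
  have ms: "m \<in> memory_space P t" using m by (simp add: feasible_def)
  have snoc: "accrued P t (snd m @ [u]) = accrued P t (snd m)"
    using memory_spaceD[OF ms] by (auto simp: accrued_snoc)
  have acc: "accrued P t (snd m) \<omega> \<in> {0..accrued_max P}" if "\<omega> \<in> cond_samples P t m" for \<omega>
    using accrued_in[OF ms that] .
  have joint: "{a \<in> {0..accrued_max P}. ((c, s'), a) \<in> joint_range_act P \<sigma> t m u} =
      accrued P t (snd m) ` {\<omega> \<in> cond_samples P t m. cost_at P t (snd m @ [u]) \<omega> = c \<and>
        \<sigma> (Suc t) (next_memory P t m u \<omega>) = s'}" (is "_ = _ ` ?W")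
    using acc by (auto simp: joint_range_act_def snoc)
  have marginal: "{a \<in> {0..accrued_max P}. a \<in> accrued_range_act P t m u} =
      accrued P t (snd m) ` cond_samples P t m"
    using acc by (auto simp: accrued_range_act_def snoc)
  obtain a where a: "accrued_sup t m = ereal a" by (rule accrued_sup_finite[OF m])
  have "\<rho> c s' (\<sigma> t m) u = accrued_distribution P \<sigma> t c s' m u"
    using info[unfolded information_state_def] m u c s' by metis
  also have "\<dots> = (SUP \<omega>\<in>?W. ereal (accrued P t (snd m) \<omega>)) - ereal a"
    (is "_ = ?sup - _")
    unfolding accrued_distribution_def SUP_add_range_indicator joint marginal
    by (simp add: image_image flip: a accrued_sup_alt)
  finally show ?thesis
    unfolding a by (cases ?sup) auto
qed

text \<open>
  The recursion moves from information states back to memories. Although \<open>\<sigma> (Suc t)\<close> need not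
  determine the next memory, nothing is lost: the worst sample for a given \<open>(c, s')\<close> is the one
  with the largest accrued cost, and \<open>\<rho>\<close> records exactly that cost.
\<close>

lemma horizon_value_Suc:
  assumes m: "feasible P t m"
  shows "horizon_value (Suc n) t m =
    (INF u\<in>act_set P. SUP \<omega>\<in>cond_samples P t m. horizon_value n (Suc t) (next_memory P t m u \<omega>))"
proof -
  have ms: "m \<in> memory_space P t" using m by (simp add: feasible_def)
  let ?z = "\<gamma> ^ t" and ?L = "\<lambda>s'. bellman_iter P S \<rho> n s' (\<gamma> ^ Suc t)"
  note z = discount_power_bounds[of t]
  have g: "\<gamma> \<noteq> 0" using discount_bounds by simp
  obtain a where a: "accrued_sup t m = ereal a" by (rule accrued_sup_finite[OF m])
  \<comment> \<open>The affine map \<open>x \<mapsto> \<alpha> + \<gamma>\<^sup>t x\<close> has been moved inside the infimum and the supremum.\<close>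
  have step: "(SUP (c, s')\<in>cost_set P \<times> S.
        ereal a + ereal ?z * (ereal c + ereal \<gamma> * ?L s' + \<rho> c s' (\<sigma> t m) u / ereal ?z)) =
      (SUP \<omega>\<in>cond_samples P t m. horizon_value n (Suc t) (next_memory P t m u \<omega>))"
    (is "?lhs = ?rhs") if u: "u \<in> act_set P" for u
  proof -
    let ?m = "next_memory P t m u" and ?c = "cost_at P t (snd m @ [u])"
    let ?s = "\<lambda>\<omega>. \<sigma> (Suc t) (?m \<omega>)"
    let ?Om = "cond_samples P t m"
    let ?f = "\<lambda>\<omega>. ereal (?z * ?c \<omega>) + ereal (\<gamma> ^ Suc t) * ?L (?s \<omega>) + ereal (accrued P t (snd m) \<omega>)"
    have in_range: "?c \<omega> \<in> cost_set P" "?s \<omega> \<in> S" if "\<omega> \<in> ?Om" for \<omega>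
      using that memory_spaceD[OF ms] u state_in[OF feasible_next_memory[OF m u that]]
      by (auto simp: cond_samples_def intro!: cost_at_in)
    have Lfin: "\<exists>x. ?L s' = ereal x" if "s' \<in> S" for s'
      using bellman_iter_finite[OF that discount_power_bounds] by metis
    have "ereal a + ereal ?z * (ereal c + ereal \<gamma> * ?L s' + \<rho> c s' (\<sigma> t m) u / ereal ?z) =
        (SUP \<omega>\<in>{\<omega> \<in> ?Om. (?c \<omega>, ?s \<omega>) = (c, s')}. ?f \<omega>)"
      if cs: "c \<in> cost_set P" "s' \<in> S" for c s'
    proof -
      obtain x where x: "?L s' = ereal x" using Lfin cs by blast
      have "ereal a + ereal ?z * (ereal c + ereal \<gamma> * ?L s' + \<rho> c s' (\<sigma> t m) u / ereal ?z) =
          ereal (?z * c + \<gamma> ^ Suc t * x) + (ereal a + \<rho> c s' (\<sigma> t m) u)"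
        unfolding x using g z by (cases "\<rho> c s' (\<sigma> t m) u") (auto simp: algebra_simps)
      also have "\<dots> = (SUP \<omega>\<in>{\<omega> \<in> ?Om. ?c \<omega> = c \<and> ?s \<omega> = s'}.
          ereal (?z * c + \<gamma> ^ Suc t * x) + ereal (accrued P t (snd m) \<omega>))"
        unfolding a[symmetric] accrued_sup_plus_cost_distribution[OF m u cs] ereal_add_SUP ..
      also have "\<dots> = (SUP \<omega>\<in>{\<omega> \<in> ?Om. (?c \<omega>, ?s \<omega>) = (c, s')}. ?f \<omega>)"
        using x by (intro SUP_cong) auto
      finally show ?thesis .
    qed
    then have "?lhs = (SUP p\<in>cost_set P \<times> S. SUP \<omega>\<in>{\<omega> \<in> ?Om. (?c \<omega>, ?s \<omega>) = p}. ?f \<omega>)"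
      by (intro SUP_cong) auto
    \<comment> \<open>Regroup the samples: first drop the grouping by \<open>(c, s')\<close>, then group by the next memory.\<close>
    also have "\<dots> = (SUP \<omega>\<in>?Om. ?f \<omega>)"
      by (rule SUP_by_values) (use in_range in auto)
    also have "\<dots> = (SUP \<omega>\<in>?Om. SUP \<omega>'\<in>{\<omega>' \<in> ?Om. ?m \<omega>' = ?m \<omega>}. ?f \<omega>')"
      by (rule SUP_fibres[symmetric])
    also have "\<dots> = ?rhs"
    proof (rule SUP_cong[OF refl])
      fix \<omega> assume w: "\<omega> \<in> ?Om"
      obtain x where x: "?L (?s \<omega>) = ereal x" using Lfin in_range[OF w] by blast
      have us: "snd (?m \<omega>) = snd m @ [u]" by (simp add: next_memory_def)
      have "horizon_value n (Suc t) (?m \<omega>) =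
          ereal (\<gamma> ^ Suc t * x) + accrued_sup (Suc t) (?m \<omega>)"
        by (simp add: horizon_value_def x[simplified] add.commute)
      also have "\<dots> = (SUP \<omega>'\<in>{\<omega>' \<in> ?Om. ?m \<omega>' = ?m \<omega>}. ?f \<omega>')"
        unfolding accrued_sup_alt cond_samples_next_memory[OF ms] ereal_add_SUP us
        using memory_spaceD[OF ms] x
        by (intro SUP_cong) (auto simp: accrued_Suc accrued_snoc algebra_simps)
      finally show "(SUP \<omega>'\<in>{\<omega>' \<in> ?Om. ?m \<omega>' = ?m \<omega>}. ?f \<omega>') = horizon_value n (Suc t) (?m \<omega>)" ..
    qed
    finally show ?thesis .
  qed
  have "horizon_value (Suc n) t m = (INF u\<in>act_set P. SUP p\<in>cost_set P \<times> S.
      ereal a + ereal ?z * (case p of (c, s') \<Rightarrow>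
        ereal c + ereal \<gamma> * ?L s' + \<rho> c s' (\<sigma> t m) u / ereal ?z))"
    unfolding horizon_value_def bellman_iter_Suc bellman_op_def a
      ereal_affine_INF[OF z(1)] ereal_affine_SUP[OF z(1)]
    by (simp only: power_Suc)
  also have "\<dots> = (INF u\<in>act_set P. SUP \<omega>\<in>cond_samples P t m.
      horizon_value n (Suc t) (next_memory P t m u \<omega>))"
    using step by (intro INF_cong) (auto simp: case_prod_unfold)
  finally show ?thesis .
qed

section \<open>Bounds on the optimal value\<close>

text \<open>
  In the induction step the exponent is unchanged, since \<open>Suc n + t = n + Suc t\<close>: horizon and
  starting time move in opposite directions and the end of the horizon stays fixed.
\<close>

lemma horizon_value_le_strategy_value:
  assumes g: "g \<in> strategies P" and m: "feasible P t m"
  shows "ereal (\<gamma> ^ (n + t) * cost_min P / (1 - \<gamma>)) + horizon_value n t m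
    \<le> strategy_value P g t m"
  using m
proof (induction n arbitrary: t m)
  case 0
  then show ?case using strategy_value_bounds(1)[OF g, of m t]
    by (simp add: horizon_value_0 feasible_def)
next
  case (Suc n)
  have ms: "m \<in> memory_space P t" using Suc.prems by (simp add: feasible_def)
  have u: "g t m \<in> act_set P" by (rule strategiesD[OF g ms])
  let ?k = "ereal (\<gamma> ^ (n + Suc t) * cost_min P / (1 - \<gamma>))"
  let ?m = "next_memory P t m (g t m)"
  have "?k + horizon_value (Suc n) t m
      \<le> ?k + (SUP \<omega>\<in>cond_samples P t m. horizon_value n (Suc t) (?m \<omega>))"
    unfolding horizon_value_Suc[OF Suc.prems] by (intro add_left_mono INF_lower u)
  also have "\<dots> = (SUP \<omega>\<in>cond_samples P t m. ?k + horizon_value n (Suc t) (?m \<omega>))"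
    by (rule ereal_add_SUP)
  also have "\<dots> \<le> (SUP \<omega>\<in>cond_samples P t m. strategy_value P g (Suc t) (?m \<omega>))"
    by (intro SUP_subset_mono[OF subset_refl]) (intro Suc.IH feasible_next_memory[OF Suc.prems u])
  also have "\<dots> = strategy_value P g t m"
    by (rule strategy_value_Suc[OF g ms, symmetric])
  finally show ?case by simp
qed

text \<open>
  The time \<open>T\<close> at which the horizon ends is fixed, so the current time determines the remaining
  horizon and hence which infimum the strategy has to approximate. From time \<open>T\<close> on, and at
  infeasible memories, any action will do. That the horizon values are finite is what makes adding
  \<open>e\<close> leave room above the infimum.
\<close>

lemma near_optimal_strategy_exists:
  assumes e: "0 < e"
  obtains g where "g \<in> strategies P"
    and "\<And>k n m. k + Suc n = T \<Longrightarrow> feasible P k m \<Longrightarrow>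
      (SUP \<omega>\<in>cond_samples P k m. horizon_value n (Suc k) (next_memory P k m (g k m) \<omega>))
      \<le> horizon_value (Suc n) k m + ereal e"
proof -
  let ?Q = "\<lambda>k m u. \<forall>n. k + Suc n = T \<longrightarrow> feasible P k m \<longrightarrow>
      (SUP \<omega>\<in>cond_samples P k m. horizon_value n (Suc k) (next_memory P k m u \<omega>))
      \<le> horizon_value (Suc n) k m + ereal e"
  have "\<exists>u\<in>act_set P. ?Q k m u" for k m
  proof (cases "k < T \<and> feasible P k m")
    case True
    then obtain n where n: "T = k + Suc n" by (metis add_Suc_right less_imp_Suc_add)
    obtain x where "horizon_value (Suc n) k m = ereal x"
      using horizon_value_finite True by blast
    then have "horizon_value (Suc n) k m < horizon_value (Suc n) k m + ereal e"
      using e by simp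
    then obtain u where "u \<in> act_set P"
      "(SUP \<omega>\<in>cond_samples P k m. horizon_value n (Suc k) (next_memory P k m u \<omega>))
        < horizon_value (Suc n) k m + ereal e"
      using horizon_value_Suc[of k m n] True by (metis (no_types, lifting) INF_less_iff)
    then show ?thesis by (intro bexI[of _ u]) (auto simp: n)
  next
    case False
    then show ?thesis using act_set_nonempty by auto
  qed
  then obtain g where "\<And>k m. g k m \<in> act_set P" "\<And>k m. ?Q k m (g k m)"
    by metis
  then show ?thesis by (intro that[of g]) (auto simp: strategies_def)
qed

lemma near_optimal_strategy_value_le:
  assumes g: "g \<in> strategies P"
    and opt: "\<And>k n m. k + Suc n = T \<Longrightarrow> feasible P k m \<Longrightarrow>
      (SUP \<omega>\<in>cond_samples P k m. horizon_value n (Suc k) (next_memory P k m (g k m) \<omega>))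
      \<le> horizon_value (Suc n) k m + ereal e"
    and "t + n = T" and "feasible P t m"
  shows "strategy_value P g t m
    \<le> ereal (\<gamma> ^ (n + t) * cost_max P / (1 - \<gamma>) + real n * e) + horizon_value n t m"
  using assms(3,4)
proof (induction n arbitrary: t m)
  case 0
  then show ?case using strategy_value_bounds(2)[OF g, of m t]
    by (simp add: horizon_value_0 feasible_def)
next
  case (Suc n)
  have ms: "m \<in> memory_space P t" using Suc.prems by (simp add: feasible_def)
  have u: "g t m \<in> act_set P" by (rule strategiesD[OF g ms])
  let ?k = "\<gamma> ^ (n + Suc t) * cost_max P / (1 - \<gamma>) + real n * e"
  let ?m = "next_memory P t m (g t m)"
  have "strategy_value P g t m = (SUP \<omega>\<in>cond_samples P t m. strategy_value P g (Suc t) (?m \<omega>))"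
    by (rule strategy_value_Suc[OF g ms])
  also have "\<dots> \<le> (SUP \<omega>\<in>cond_samples P t m. ereal ?k + horizon_value n (Suc t) (?m \<omega>))"
    by (intro SUP_subset_mono[OF subset_refl] Suc.IH feasible_next_memory u) (use Suc.prems in auto)
  also have "\<dots> = ereal ?k + (SUP \<omega>\<in>cond_samples P t m. horizon_value n (Suc t) (?m \<omega>))"
    by (rule ereal_add_SUP[symmetric])
  also have "\<dots> \<le> ereal ?k + (horizon_value (Suc n) t m + ereal e)"
    by (intro add_left_mono opt Suc.prems)
  also have "\<dots> = ereal (\<gamma> ^ (Suc n + t) * cost_max P / (1 - \<gamma>) + real (Suc n) * e)
      + horizon_value (Suc n) t m"
    by (cases "horizon_value (Suc n) t m") (auto simp: algebra_simps)
  finally show ?case .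
qed

lemma optimal_value_le_horizon_value:
  assumes m: "feasible P t m"
  shows "optimal_value P t m
    \<le> ereal (\<gamma> ^ (n + t) * cost_max P / (1 - \<gamma>)) + horizon_value n t m"
proof (rule ereal_le_epsilon2)
  fix e :: real assume "0 < e"
  \<comment> \<open>Share \<open>e\<close> among the \<open>n\<close> steps; \<open>Suc n\<close> avoids a division by \<open>0\<close>.\<close>
  define d where "d = e / real (Suc n)"
  have d: "0 < d" "real n * d \<le> e" using \<open>0 < e\<close> by (auto simp: d_def field_simps)
  obtain g where g: "g \<in> strategies P"
    and opt: "\<And>k j m. k + Suc j = t + n \<Longrightarrow> feasible P k m \<Longrightarrow>
      (SUP \<omega>\<in>cond_samples P k m. horizon_value j (Suc k) (next_memory P k m (g k m) \<omega>))
      \<le> horizon_value (Suc j) k m + ereal d"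
    using near_optimal_strategy_exists[OF d(1), of "t + n"] by blast
  have "optimal_value P t m \<le> strategy_value P g t m"
    unfolding optimal_value_def using g by (rule INF_lower)
  also have "\<dots> \<le> ereal (\<gamma> ^ (n + t) * cost_max P / (1 - \<gamma>) + real n * d) + horizon_value n t m"
    by (rule near_optimal_strategy_value_le[OF g opt refl m])
  also have "\<dots> \<le> ereal (\<gamma> ^ (n + t) * cost_max P / (1 - \<gamma>)) + horizon_value n t m + ereal e"
    using d(2) by (cases "horizon_value n t m") auto
  finally show "optimal_value P t m
    \<le> ereal (\<gamma> ^ (n + t) * cost_max P / (1 - \<gamma>)) + horizon_value n t m + ereal e" .
qed

end

theorem theorem1:
  fixes P :: "('o, 'e::metric_space) uncertain_system"
    and S :: "'s::metric_space set"
    and \<sigma> :: "nat \<Rightarrow> 'e memory \<Rightarrow> 's"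
    and \<rho> :: "real \<Rightarrow> 's \<Rightarrow> 's \<Rightarrow> 'e \<Rightarrow> ereal"
    and n t :: nat and m :: "'e memory"
  assumes "valid_system P"
    and "information_state P S \<sigma> \<rho>"
    and "feasible P t m"
  shows "ereal (discount P ^ (n + t) * cost_min P / (1 - discount P))
           + ereal (discount P ^ t) * bellman_iter P S \<rho> n (\<sigma> t m) (discount P ^ t)
           + (SUP a\<in>accrued_range P t m. ereal a)
         \<le> optimal_value P t m
       \<and> optimal_value P t m
         \<le> (SUP a\<in>accrued_range P t m. ereal a)
           + ereal (discount P ^ t) * bellman_iter P S \<rho> n (\<sigma> t m) (discount P ^ t)
           + ereal (discount P ^ (n + t) * cost_max P / (1 - discount P))"
proof -
  interpret information_state_system P S \<sigma> \<rho>
    using assms(1,2) by unfold_locales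
  have "ereal (\<gamma> ^ (n + t) * cost_min P / (1 - \<gamma>)) + horizon_value n t m \<le> optimal_value P t m"
    unfolding optimal_value_def
    by (rule INF_greatest) (rule horizon_value_le_strategy_value[OF _ assms(3)])
  with optimal_value_le_horizon_value[OF assms(3), of n] show ?thesis
    by (simp add: horizon_value_def ac_simps)
qed

end
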